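(* For all integers $k, \ell \geq 1$, $$Q_{132}^{(k,0,\ell,0)}(t,x) = \frac{1}{1-t\, Q_{132}^{(k-1,0,\ell,0)}(t,x)}$$ as formal power series in $t$ with coefficients in $\mathbb{Z}[x]$.
   Context: Let $\mathbb{N}=\{0,1,2,\ldots\}$ and let $S_n$ be the set of permutations $\sigma=\sigma_1\cdots\sigma_n$ of $\{1,\ldots,n\}$ in one-line notation. $S_n(132)$ denotes the set of $\sigma\in S_n$ that avoid the pattern $132$, i.e. there are no indices $i_1<i_2<i_3$ with $\sigma_{i_1}<\sigma_{i_3}<\sigma_{i_2}$. For $a,b,c,d\in\mathbb{N}$ and $\sigma\in S_n$, say that $\sigma_i$ matches the quadrant marked mesh pattern $\mathrm{MMP}(a,b,c,d)$ in $\sigma$ if: at least $a$ indices $j>i$ have $\sigma_j>\sigma_i$; at least $b$ indices $j<i$ have $\sigma_j>\sigma_i$; at least $c$ indices $j<i$ have $\sigma_j<\sigma_i$; and at least $d$ indices $j>i$ have $\sigma_j<\sigma_i$. Let $\mathrm{mmp}^{(a,b,c,d)}(\sigma)$ be the number of $i$ such that $\sigma_i$ matches $\mathrm{MMP}(a,b,c,d)$ in $\sigma$. Define $Q_{n,132}^{(a,b,c,d)}(x)=\sum_{\sigma\in S_n(132)}x^{\mathrm{mmp}^{(a,b,c,d)}(\sigma)}$ for $n\geq 1$, and $Q_{132}^{(a,b,c,d)}(t,x)=1+\sum_{n\geq 1}t^n Q_{n,132}^{(a,b,c,d)}(x)$. *)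

theory Defs
  imports
    "HOL-Combinatorics.Multiset_Permutations"
    "HOL-Computational_Algebra.Polynomial"
    "HOL-Computational_Algebra.Formal_Power_Series"
begin

text \<open>
  A permutation \<open>\<sigma>\<close> of \<open>{1..n}\<close> is represented by its one-line notation, a list. List positions
  are counted from \<open>0\<close>, so \<open>\<sigma> ! i\<close> is the letter usually written with index \<open>i + 1\<close>.
\<close>

definition avoids_132 :: "nat list \<Rightarrow> bool" where
  "avoids_132 \<sigma> \<longleftrightarrow>
     \<not> (\<exists>i j k. i < j \<and> j < k \<and> k < length \<sigma> \<and> \<sigma> ! i < \<sigma> ! k \<and> \<sigma> ! k < \<sigma> ! j)"

definition perms_132 :: "nat \<Rightarrow> nat list set" where
  "perms_132 n = {\<sigma> \<in> permutations_of_set {1..n}. avoids_132 \<sigma>}"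

definition matches_MMP :: "nat \<Rightarrow> nat \<Rightarrow> nat \<Rightarrow> nat \<Rightarrow> nat list \<Rightarrow> nat \<Rightarrow> bool" where
  "matches_MMP a b c d \<sigma> i \<longleftrightarrow>
     a \<le> card {j \<in> {i<..<length \<sigma>}. \<sigma> ! j > \<sigma> ! i} \<and>
     b \<le> card {j \<in> {..<i}. \<sigma> ! j > \<sigma> ! i} \<and>
     c \<le> card {j \<in> {..<i}. \<sigma> ! j < \<sigma> ! i} \<and>
     d \<le> card {j \<in> {i<..<length \<sigma>}. \<sigma> ! j < \<sigma> ! i}"

definition mmp :: "nat \<Rightarrow> nat \<Rightarrow> nat \<Rightarrow> nat \<Rightarrow> nat list \<Rightarrow> nat" where
  "mmp a b c d \<sigma> = card {i \<in> {..<length \<sigma>}. matches_MMP a b c d \<sigma> i}"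

definition Qn_132 :: "nat \<Rightarrow> nat \<Rightarrow> nat \<Rightarrow> nat \<Rightarrow> nat \<Rightarrow> int poly" where
  "Qn_132 a b c d n = (\<Sum>\<sigma>\<in>perms_132 n. monom 1 (mmp a b c d \<sigma>))"

definition Q_132 :: "nat \<Rightarrow> nat \<Rightarrow> nat \<Rightarrow> nat \<Rightarrow> int poly fps" where
  "Q_132 a b c d = Abs_fps (\<lambda>n. if n = 0 then 1 else Qn_132 a b c d n)"

text \<open>
  The type \<^typ>\<open>int poly\<close> is not an instance of class \<^class>\<open>inverse\<close>, so the division notation for
  formal power series is not available over it. The reciprocal of a series with constant
  coefficient \<open>1\<close> is the library's \<open>fps_right_inverse f 1\<close> (the argument \<open>1\<close> being the inverse
  of the constant coefficient), which is the multiplicative inverse of \<open>f\<close> in the ring of power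
  series:
\<close>

lemma fps_right_inverse_1_unique:
  fixes f g :: "'a :: comm_ring_1 fps"
  assumes "fps_nth f 0 = 1"
  shows "g = fps_right_inverse f 1 \<longleftrightarrow> f * g = 1"
proof
  have inv: "f * fps_right_inverse f 1 = 1"
    using assms by (intro fps_right_inverse) simp
  show "f * g = 1" if "g = fps_right_inverse f 1"
    using that inv by simp
  show "g = fps_right_inverse f 1" if "f * g = 1"
    using that inv by (metis mult.assoc mult.commute mult.right_neutral)
qed

end

theory Submission
  imports Defs
begin

text \<open>
  Let \<open>m\<close> be the largest letter of a \<open>132\<close>-avoiding permutation \<open>\<sigma> = A m
  B\<close> of length \<open>n\<close>. A letter of \<open>A\<close> below a letter of \<open>B\<close> would
  form a \<open>132\<close> pattern with \<open>m\<close> between them, so every letter of \<open>A\<close>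
  exceeds every letter of \<open>B\<close>; conversely, two \<open>132\<close>-avoiding words in this relative
  position can be joined freely. Hence \<open>\<sigma>\<close> amounts to a pair of \<open>132\<close>-avoiding
  permutations whose lengths add up to \<open>n - 1\<close> (\<open>bij_betw_join_at_peak\<close>).

  The statistic splits along this decomposition (\<open>mmp_peak\<close>). A letter of \<open>A\<close> sees, to
  its upper right, what it sees inside \<open>A\<close> and in addition \<open>m\<close>, and its lower left
  quadrant lies inside \<open>A\<close>, while \<open>B\<close> lies in its lower right quadrant, which the
  pattern does not constrain; so it matches \<open>MMP(k,0,l,0)\<close> in \<open>\<sigma>\<close> exactly if it
  matches \<open>MMP(k-1,0,l,0)\<close> in \<open>A\<close>. The letter \<open>m\<close> has nothing to its
  upper right and, as \<open>k > 0\<close>, never matches. For a letter of \<open>B\<close> everything outside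
  \<open>B\<close> lies in its upper left quadrant, which is not constrained either. Therefore the coefficients
  satisfy the convolution recurrence that says \<open>Q\<^sub>k = 1 + t * Q\<^sub>k\<^sub>-\<^sub>1 *
  Q\<^sub>k\<close>, that is \<open>(1 - t * Q\<^sub>k\<^sub>-\<^sub>1) * Q\<^sub>k = 1\<close>.
\<close>

section \<open>Words split at their largest letter\<close>

text \<open>The relative position of the three blocks that avoidance of \<open>132\<close> forces.\<close>

definition peak_split :: "nat list \<Rightarrow> nat \<Rightarrow> nat list \<Rightarrow> bool" where
  "peak_split A m B \<longleftrightarrow> (\<forall>a\<in>set A. \<forall>b\<in>set B. b < a) \<and> (\<forall>x\<in>set A \<union> set B. x < m)"

lemma nth_right_block: "(A @ m # B) ! (Suc (length A) + i) = B ! i"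
  by (simp add: nth_append)

lemma peak_split_nth:
  assumes "peak_split A m B"
  shows "i < length A \<Longrightarrow> A ! i < m"
    and "j < length B \<Longrightarrow> B ! j < m"
    and "i < length A \<Longrightarrow> j < length B \<Longrightarrow> B ! j < A ! i"
  using assms by (auto simp: peak_split_def)

lemma index_block_cases:
  assumes "i < length (A @ m # B)"
  obtains (left) "i < length A" | (peak) "i = length A"
    | (right) i' where "i = Suc (length A) + i'" "i' < length B"
proof -
  consider "i < length A" | "i = length A" | "i > length A" by linarith
  then show thesis
  proof cases
    case 3
    then show thesis using assms right[of "i - Suc (length A)"] by simp
  qed (use left peak in auto)
qed

text \<open>
  A pattern \<open>132\<close> cannot straddle the blocks: its first letter is smaller than the other two, so
  it cannot lie in \<open>A\<close> with the last one in \<open>B\<close>, and \<open>m\<close> cannot be its first or last letter.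
\<close>

lemma avoids_132_peak:
  assumes "peak_split A m B"
  shows "avoids_132 (A @ m # B) \<longleftrightarrow> avoids_132 A \<and> avoids_132 B"
proof (intro iffI conjI)
  assume *: "avoids_132 (A @ m # B)"
  show "avoids_132 A"
    unfolding avoids_132_def
  proof (intro notI, elim exE conjE)
    fix i j k assume "i < j" "j < k" "k < length A" "A ! i < A ! k" "A ! k < A ! j"
    then show False
      using * unfolding avoids_132_def
      by (elim notE, intro exI[of _ i] exI[of _ j] exI[of _ k]) (simp add: nth_append)
  qed
  show "avoids_132 B"
    unfolding avoids_132_def
  proof (intro notI, elim exE conjE)
    fix i j k assume "i < j" "j < k" "k < length B" "B ! i < B ! k" "B ! k < B ! j"
    then show False
      using * unfolding avoids_132_def
      by (elim notE, intro exI[of _ "Suc (length A) + i"] exI[of _ "Suc (length A) + j"]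
          exI[of _ "Suc (length A) + k"]) (simp add: nth_append)
  qed
next
  assume *: "avoids_132 A \<and> avoids_132 B"
  note less = peak_split_nth[OF assms]
  show "avoids_132 (A @ m # B)"
    unfolding avoids_132_def
  proof (intro notI, elim exE conjE)
    fix i j k
    let ?s = "A @ m # B"
    assume ijk: "i < j" "j < k" "k < length ?s" "?s ! i < ?s ! k" "?s ! k < ?s ! j"
    have i: "i < length ?s" using ijk by simp
    have j: "j < length ?s" using ijk by simp
    from ijk(3) show False
    proof (cases rule: index_block_cases)
      case left
      then have "A ! i < A ! k" "A ! k < A ! j"
        using ijk by (simp_all add: nth_append)
      then show False using * ijk left by (auto simp: avoids_132_def)
    next
      case peak
      then show False using ijk less(1)[of j] by (simp add: nth_append)
    next
      case (right k')
      have k: "?s ! k = B ! k'" using right nth_right_block by metis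
      from i show False
      proof (cases rule: index_block_cases)
        case left
        then show False
          using ijk(4) less(3)[OF left right(2)] unfolding k by (simp add: nth_append)
      next
        case peak
        then show False using ijk(4) less(2)[OF right(2)] unfolding k by simp
      next
        case (right i')
        obtain j' where j': "j = Suc (length A) + j'"
          using right ijk(1) by (metis less_imp_add_positive add.assoc)
        have "i' < j'" "j' < k'" "k' < length B" "B ! i' < B ! k'" "B ! k' < B ! j'"
          using ijk right j' \<open>k = Suc (length A) + k'\<close> by (simp_all add: nth_append)
        then show False using * by (auto simp: avoids_132_def)
      qed
    qed
  qed
qed

text \<open>Otherwise \<open>a < b\<close> with \<open>a\<close> in \<open>A\<close> and \<open>b\<close> in \<open>B\<close> would make \<open>a m b\<close> a pattern \<open>132\<close>.\<close>

lemma avoids_132_imp_peak_split: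
  assumes avoids: "avoids_132 (A @ m # B)" and dist: "distinct (A @ m # B)"
    and max: "\<forall>x\<in>set A \<union> set B. x < m"
  shows "peak_split A m B"
  unfolding peak_split_def
proof (intro conjI ballI)
  show "x < m" if "x \<in> set A \<union> set B" for x using that max by blast
  fix a b assume ab: "a \<in> set A" "b \<in> set B"
  show "b < a"
  proof (rule ccontr)
    assume "\<not> b < a"
    with ab dist have "a < b" by fastforce
    obtain i where i: "i < length A" "A ! i = a" using ab by (auto simp: in_set_conv_nth)
    obtain k where k: "k < length B" "B ! k = b" using ab by (auto simp: in_set_conv_nth)
    have "b < m" using ab max by auto
    with \<open>a < b\<close> i k avoids show False
      unfolding avoids_132_def
      by (elim notE, intro exI[of _ i] exI[of _ "length A"] exI[of _ "Suc (length A) + k"])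
        (simp add: nth_append)
  qed
qed

section \<open>The statistic along the split\<close>

lemma matches_MMP_left_block:
  assumes "peak_split A m B" and i: "i < length A"
  shows "matches_MMP (Suc a) 0 c 0 (A @ m # B) i \<longleftrightarrow> matches_MMP a 0 c 0 A i"
proof -
  let ?s = "A @ m # B"
  note less = peak_split_nth[OF assms(1)]
  have upper: "{j \<in> {i<..<length ?s}. ?s ! j > ?s ! i}
      = insert (length A) {j \<in> {i<..<length A}. A ! j > A ! i}" (is "?L = ?R")
  proof (intro set_eqI iffI)
    fix j assume j: "j \<in> ?L"
    then have "j < length ?s" by simp
    then show "j \<in> ?R"
    proof (cases rule: index_block_cases)
      case (right j')
      then show ?thesis using j i less(3)[OF i right(2)] by (simp add: nth_append)
    qed (use i j in \<open>auto simp: nth_append\<close>)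
  next
    fix j assume "j \<in> ?R"
    then show "j \<in> ?L" using i less(1)[OF i] by (auto simp: nth_append)
  qed
  have lower: "{j \<in> {..<i}. ?s ! j < ?s ! i} = {j \<in> {..<i}. A ! j < A ! i}"
    using i by (auto simp: nth_append)
  show ?thesis
    unfolding matches_MMP_def upper lower by simp
qed

lemma not_matches_MMP_peak:
  assumes "peak_split A m B"
  shows "\<not> matches_MMP (Suc a) b c d (A @ m # B) (length A)"
proof -
  let ?s = "A @ m # B"
  have "{j \<in> {length A<..<length ?s}. ?s ! j > ?s ! length A} = {}" (is "?L = _")
  proof (rule ccontr)
    assume "?L \<noteq> {}"
    then obtain j where j: "j < length ?s" "length A < j" "?s ! j > m" by auto
    from j(1) show False
    proof (cases rule: index_block_cases)
      case (right j')
      then show False using j peak_split_nth(2)[OF assms right(2)] by (simp add: nth_append)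
    qed (use j in auto)
  qed
  then have "card ?L = 0" by simp
  then show ?thesis unfolding matches_MMP_def by linarith
qed

lemma card_image_add_left: "card ((\<lambda>i. n + i) ` S) = card S" for n :: nat
  by (simp add: card_image)

lemma matches_MMP_right_block:
  assumes "peak_split A m B" and i: "i < length B"
  shows "matches_MMP a 0 c 0 (A @ m # B) (Suc (length A) + i) \<longleftrightarrow> matches_MMP a 0 c 0 B i"
proof -
  let ?s = "A @ m # B" and ?f = "\<lambda>i. Suc (length A) + i"
  note less = peak_split_nth[OF assms(1)]
  have upper: "{j \<in> {?f i<..<length ?s}. ?s ! j > ?s ! ?f i}
      = ?f ` {j \<in> {i<..<length B}. B ! j > B ! i}" (is "?L = ?R")
  proof (intro set_eqI iffI)
    fix j assume j: "j \<in> ?L"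
    then have "j < length ?s" by simp
    then show "j \<in> ?R"
    proof (cases rule: index_block_cases)
      case (right j')
      then show ?thesis using j by (intro image_eqI[of _ _ j']) (auto simp: nth_append)
    qed (use j in auto)
  qed (auto simp: nth_append)
  have lower: "{j \<in> {..<?f i}. ?s ! j < ?s ! ?f i} = ?f ` {j \<in> {..<i}. B ! j < B ! i}"
    (is "?L = ?R")
  proof (intro set_eqI iffI)
    fix j assume j: "j \<in> ?L"
    then have "j < length ?s" using i by simp
    then show "j \<in> ?R"
    proof (cases rule: index_block_cases)
      case left
      then show ?thesis using j less(3)[OF left i] by (simp add: nth_append)
    next
      case peak
      then show ?thesis using j less(2)[OF i] by (simp add: nth_append)
    next
      case (right j')
      then show ?thesis using j by (intro image_eqI[of _ _ j']) (auto simp: nth_append)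
    qed
  qed (auto simp: nth_append)
  show ?thesis
    unfolding matches_MMP_def upper lower card_image_add_left by simp
qed

text \<open>
  The peak costs the letters of \<open>A\<close> exactly one of the \<open>a + 1\<close> larger letters required to their
  right, and is invisible to the constrained quadrants of the letters of \<open>B\<close>.
\<close>

lemma mmp_peak:
  assumes "peak_split A m B"
  shows "mmp (Suc a) 0 c 0 (A @ m # B) = mmp a 0 c 0 A + mmp (Suc a) 0 c 0 B"
proof -
  let ?s = "A @ m # B" and ?f = "\<lambda>i. Suc (length A) + i"
  let ?SA = "{i \<in> {..<length A}. matches_MMP a 0 c 0 A i}"
  let ?SB = "{i \<in> {..<length B}. matches_MMP (Suc a) 0 c 0 B i}"
  have "{i \<in> {..<length ?s}. matches_MMP (Suc a) 0 c 0 ?s i} = ?SA \<union> ?f ` ?SB"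
    (is "?L = ?R")
  proof (intro set_eqI iffI)
    fix i assume i: "i \<in> ?L"
    then have "i < length ?s" by simp
    then show "i \<in> ?R"
    proof (cases rule: index_block_cases)
      case left
      then show ?thesis using i matches_MMP_left_block[OF assms left] by simp
    next
      case peak
      then show ?thesis using i not_matches_MMP_peak[OF assms] by simp
    next
      case (right i')
      then show ?thesis using i matches_MMP_right_block[OF assms right(2)] by auto
    qed
  next
    fix i assume "i \<in> ?R"
    then show "i \<in> ?L"
      using matches_MMP_left_block[OF assms] matches_MMP_right_block[OF assms] by auto
  qed
  moreover have "card (?SA \<union> ?f ` ?SB) = card ?SA + card (?f ` ?SB)"
    by (rule card_Un_disjoint) auto
  ultimately have "card ?L = card ?SA + card (?f ` ?SB)" by (rule trans[OF arg_cong])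
  then show ?thesis unfolding mmp_def card_image_add_left .
qed

section \<open>Joining two permutations at a new largest letter\<close>

text \<open>Avoidance and the statistic depend only on the relative order of the letters.\<close>

lemma avoids_132_map:
  fixes f :: "nat \<Rightarrow> nat"
  assumes "strict_mono f"
  shows "avoids_132 (map f xs) \<longleftrightarrow> avoids_132 xs"
proof -
  have "i < j \<and> j < k \<and> k < length (map f xs) \<and> map f xs ! i < map f xs ! k \<and>
      map f xs ! k < map f xs ! j \<longleftrightarrow>
      i < j \<and> j < k \<and> k < length xs \<and> xs ! i < xs ! k \<and> xs ! k < xs ! j" for i j k
  proof (cases "i < j \<and> j < k \<and> k < length xs")
    case True
    then have "i < length xs" "j < length xs" "k < length xs" by linarith+
    then show ?thesis by (simp add: strict_mono_less[OF assms])
  qed auto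
  then show ?thesis unfolding avoids_132_def by (simp only:)
qed

lemma mmp_map:
  fixes f :: "nat \<Rightarrow> nat"
  assumes "strict_mono f"
  shows "mmp a b c d (map f xs) = mmp a b c d xs"
proof -
  have "matches_MMP a b c d (map f xs) i \<longleftrightarrow> matches_MMP a b c d xs i" if "i < length xs" for i
  proof -
    have "{j \<in> {i<..<length (map f xs)}. map f xs ! j > map f xs ! i}
        = {j \<in> {i<..<length xs}. xs ! j > xs ! i}"
      "{j \<in> {..<i}. map f xs ! j > map f xs ! i} = {j \<in> {..<i}. xs ! j > xs ! i}"
      "{j \<in> {..<i}. map f xs ! j < map f xs ! i} = {j \<in> {..<i}. xs ! j < xs ! i}"
      "{j \<in> {i<..<length (map f xs)}. map f xs ! j < map f xs ! i}
        = {j \<in> {i<..<length xs}. xs ! j < xs ! i}"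
      using that by (auto simp: strict_mono_less[OF assms])
    then show ?thesis unfolding matches_MMP_def by (simp only:)
  qed
  then have "{i \<in> {..<length (map f xs)}. matches_MMP a b c d (map f xs) i}
      = {i \<in> {..<length xs}. matches_MMP a b c d xs i}" by auto
  then show ?thesis unfolding mmp_def by (rule arg_cong)
qed

lemma strict_mono_add_nat: "strict_mono (\<lambda>x::nat. x + c)"
  by (rule strict_monoI) simp

text \<open>
  The inverse of the decomposition: \<open>\<alpha>\<close> is raised just enough to lie above \<open>\<beta>\<close>, so that no value
  is skipped and the result is again a permutation of an initial segment.
\<close>

definition join_at_peak :: "nat list \<Rightarrow> nat list \<Rightarrow> nat list" where
  "join_at_peak \<alpha> \<beta> =
     map (\<lambda>x. x + length \<beta>) \<alpha> @ Suc (length \<alpha> + length \<beta>) # \<beta>"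

lemma perms_132_iff:
  "\<sigma> \<in> perms_132 n \<longleftrightarrow> set \<sigma> = {1..n} \<and> distinct \<sigma> \<and> avoids_132 \<sigma>"
  by (auto simp: perms_132_def permutations_of_set_def)

lemma length_perms_132: "\<sigma> \<in> perms_132 n \<Longrightarrow> length \<sigma> = n"
  unfolding perms_132_iff by (metis distinct_card card_atLeastAtMost diff_Suc_1)

lemma finite_perms_132: "finite (perms_132 n)"
  by (simp add: perms_132_def)

lemma peak_split_join:
  assumes "\<alpha> \<in> perms_132 a" "\<beta> \<in> perms_132 b"
  shows "peak_split (map (\<lambda>x. x + length \<beta>) \<alpha>) (Suc (length \<alpha> + length \<beta>)) \<beta>"
proof -
  have "length \<alpha> = a" "length \<beta> = b" using assms length_perms_132 by blast+
  moreover have "set \<alpha> = {1..a}" "set \<beta> = {1..b}"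
    using assms unfolding perms_132_iff by blast+
  ultimately show ?thesis by (auto simp: peak_split_def)
qed

lemma join_at_peak_in_perms_132:
  assumes "\<alpha> \<in> perms_132 a" "\<beta> \<in> perms_132 b"
  shows "join_at_peak \<alpha> \<beta> \<in> perms_132 (Suc (a + b))"
proof -
  have len: "length \<alpha> = a" "length \<beta> = b" using assms length_perms_132 by auto
  have sets: "set \<alpha> = {1..a}" "set \<beta> = {1..b}" using assms by (auto simp: perms_132_iff)
  have "(\<lambda>x. x + b) ` {1..a} = {Suc b..a + b}"
    by (simp add: image_add_atLeastAtMost')
  then have "set (join_at_peak \<alpha> \<beta>) = {1..Suc (a + b)}"
    by (auto simp: join_at_peak_def len sets)
  moreover have "distinct (join_at_peak \<alpha> \<beta>)"
    using assms by (auto simp: join_at_peak_def len sets distinct_map perms_132_iff inj_on_def)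
  moreover have "avoids_132 (join_at_peak \<alpha> \<beta>)"
    using assms unfolding join_at_peak_def
    by (simp add: avoids_132_peak[OF peak_split_join[OF assms]]
        avoids_132_map[OF strict_mono_add_nat] perms_132_iff)
  ultimately show ?thesis by (simp add: perms_132_iff)
qed

lemma mmp_join_at_peak:
  assumes "\<alpha> \<in> perms_132 i" "\<beta> \<in> perms_132 j"
  shows "mmp (Suc a) 0 c 0 (join_at_peak \<alpha> \<beta>) = mmp a 0 c 0 \<alpha> + mmp (Suc a) 0 c 0 \<beta>"
  unfolding join_at_peak_def mmp_peak[OF peak_split_join[OF assms]]
    mmp_map[OF strict_mono_add_nat] ..

lemma lower_part_of_atLeastAtMost:
  fixes S T :: "nat set"
  assumes "S \<union> T = {1..n}" and less: "\<forall>t\<in>T. \<forall>s\<in>S. s < t"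
  shows "S = {1..card S}"
proof (cases "S = {}")
  case False
  have fin: "finite S" using assms(1) by (metis finite_Un finite_atLeastAtMost)
  have "Max S \<in> S" using fin False by simp
  have "S = {1..Max S}"
  proof (intro set_eqI iffI)
    fix x assume "x \<in> S"
    then show "x \<in> {1..Max S}" using assms(1) fin by auto
  next
    fix x assume x: "x \<in> {1..Max S}"
    have "Max S \<le> n" using \<open>Max S \<in> S\<close> assms(1) by auto
    then have "x \<in> S \<union> T" using x assms(1) by auto
    moreover have "x \<notin> T" using x less \<open>Max S \<in> S\<close> by fastforce
    ultimately show "x \<in> S" by simp
  qed
  then show ?thesis by (metis card_atLeastAtMost diff_Suc_1)
qed simp

text \<open>
  In \<open>\<sigma> = A m B\<close> the letters of \<open>B\<close> are the smallest ones, so \<open>B\<close> is already a permutation of an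
  initial segment, and \<open>A\<close> becomes one after subtracting the length of \<open>B\<close>.
\<close>

lemma perms_132_Suc_obtain_join:
  assumes "\<sigma> \<in> perms_132 (Suc n)"
  obtains \<alpha> \<beta> where "\<alpha> \<in> perms_132 (n - length \<beta>)" "\<beta> \<in> perms_132 (length \<beta>)"
    "length \<beta> \<le> n" "\<sigma> = join_at_peak \<alpha> \<beta>"
proof -
  have \<sigma>: "set \<sigma> = {1..Suc n}" "distinct \<sigma>" "avoids_132 \<sigma>"
    using assms by (auto simp: perms_132_iff)
  then have "Suc n \<in> set \<sigma>" by simp
  then obtain A B where AB: "\<sigma> = A @ Suc n # B" by (meson split_list)
  have "set A \<union> set B = {1..Suc n} - {Suc n}"
    using \<sigma>(1,2) unfolding AB by auto
  also have "\<dots> = {1..n}" by auto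
  finally have sets: "set A \<union> set B = {1..n}" .
  have split: "peak_split A (Suc n) B"
  proof (rule avoids_132_imp_peak_split)
    show "avoids_132 (A @ Suc n # B)" "distinct (A @ Suc n # B)" using \<sigma> AB by simp_all
    show "\<forall>x\<in>set A \<union> set B. x < Suc n" unfolding sets by simp
  qed
  define b where "b = length B"
  have dist: "distinct A" "distinct B" "set A \<inter> set B = {}" using \<sigma>(2) AB by auto
  have setB: "set B = {1..b}"
    unfolding b_def distinct_card[OF dist(2), symmetric]
  proof (rule lower_part_of_atLeastAtMost)
    show "set B \<union> set A = {1..n}" using sets by blast
    show "\<forall>a\<in>set A. \<forall>b\<in>set B. b < a" using split unfolding peak_split_def by blast
  qed
  have "b \<le> n"
    using sets unfolding setB by (cases "b = 0") auto
  have setA: "set A = {Suc b..n}"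
  proof -
    have "set A = {1..n} - {1..b}" using sets dist(3) setB by blast
    also have "\<dots> = {Suc b..n}"
    proof (rule set_eqI)
      show "x \<in> {1..n} - {1..b} \<longleftrightarrow> x \<in> {Suc b..n}" for x
        unfolding Diff_iff atLeastAtMost_iff by linarith
    qed
    finally show ?thesis .
  qed
  have lenA: "length A = n - b"
    using distinct_card[OF dist(1)] setA by simp
  define \<alpha> where "\<alpha> = map (\<lambda>x. x - b) A"
  have A_eq: "A = map (\<lambda>x. x + b) \<alpha>"
    unfolding \<alpha>_def map_map by (rule map_idI[symmetric]) (use setA in auto)
  have "(\<lambda>x. x + b) ` set \<alpha> = (\<lambda>x. x + b) ` {1..n - b}"
  proof -
    have "(\<lambda>x. x + b) ` set \<alpha> = set A" by (simp add: A_eq)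
    also have "\<dots> = (\<lambda>x. x + b) ` {1..n - b}"
      unfolding setA image_add_atLeastAtMost' using \<open>b \<le> n\<close> by simp
    finally show ?thesis .
  qed
  then have "set \<alpha> = {1..n - b}"
    by (rule inj_image_eq_iff[OF strict_mono_imp_inj_on[OF strict_mono_add_nat], THEN iffD1])
  moreover have "distinct \<alpha>" using dist(1) unfolding A_eq by (simp add: distinct_map)
  moreover have av: "avoids_132 A" "avoids_132 B"
    using avoids_132_peak[OF split] \<sigma>(3) AB by auto
  moreover have "avoids_132 \<alpha>"
    using av(1) unfolding A_eq by (simp only: avoids_132_map[OF strict_mono_add_nat])
  ultimately have "\<alpha> \<in> perms_132 (n - b)" "B \<in> perms_132 b"
    using setB dist(2) by (simp_all add: perms_132_iff)
  moreover have "\<sigma> = join_at_peak \<alpha> B"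
  proof -
    have "length \<alpha> + length B = n" using lenA \<open>b \<le> n\<close> by (simp add: \<alpha>_def b_def)
    then show ?thesis
      using AB A_eq by (simp add: join_at_peak_def b_def)
  qed
  ultimately show thesis using that \<open>b \<le> n\<close> by (auto simp: b_def)
qed

text \<open>
  A join determines its parts: its largest letter occurs only once, so its position separates the
  two blocks, and the length of the right one gives the amount by which the left one was raised.
\<close>

lemma bij_betw_join_at_peak:
  "bij_betw (\<lambda>(i, \<alpha>, \<beta>). join_at_peak \<alpha> \<beta>)
     (SIGMA i:{0..n}. perms_132 i \<times> perms_132 (n - i)) (perms_132 (Suc n))"
proof (rule bij_betw_imageI)
  let ?f = "\<lambda>(i::nat, \<alpha>, \<beta>). join_at_peak \<alpha> \<beta>"
  let ?S = "SIGMA i:{0..n}. perms_132 i \<times> perms_132 (n - i)"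
  show "inj_on ?f ?S"
  proof (rule inj_onI)
    fix p q assume "p \<in> ?S" "q \<in> ?S" and f_eq: "?f p = ?f q"
    then obtain i \<alpha> \<beta> i' \<alpha>' \<beta>' where pq: "p = (i, \<alpha>, \<beta>)" "q = (i', \<alpha>', \<beta>')"
      and i: "i \<in> {0..n}" and i': "i' \<in> {0..n}"
      and mem: "\<alpha> \<in> perms_132 i" "\<beta> \<in> perms_132 (n - i)"
      and mem': "\<alpha>' \<in> perms_132 i'" "\<beta>' \<in> perms_132 (n - i')"
      by blast
    have eq: "join_at_peak \<alpha> \<beta> = join_at_peak \<alpha>' \<beta>'"
      using f_eq by (simp add: pq)
    have len: "length \<alpha> = i" "length \<beta> = n - i" "length \<alpha>' = i'" "length \<beta>' = n - i'"
      using mem mem' length_perms_132 by auto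
    let ?A = "map (\<lambda>x. x + (n - i)) \<alpha>" and ?A' = "map (\<lambda>x. x + (n - i')) \<alpha>'"
    have eq': "?A @ Suc n # \<beta> = ?A' @ Suc n # \<beta>'"
      using eq i i' by (simp add: join_at_peak_def len)
    have "Suc n \<notin> set ?A" "Suc n \<notin> set \<beta>"
      using mem i by (auto simp: perms_132_iff)
    then have *: "?A = ?A'" "\<beta> = \<beta>'" using eq' append_Cons_eq_iff by metis+
    have "i = i'" using arg_cong[OF *(1), of length] len by simp
    moreover have "\<alpha> = \<alpha>'"
      using *(1) unfolding \<open>i = i'\<close> by (simp add: inj_map_eq_map)
    ultimately show "p = q" using * by (simp add: pq)
  qed
  show "?f ` ?S = perms_132 (Suc n)"
  proof (intro subset_antisym subsetI)
    fix \<sigma> assume "\<sigma> \<in> ?f ` ?S"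
    then show "\<sigma> \<in> perms_132 (Suc n)"
      using join_at_peak_in_perms_132 by fastforce
  next
    fix \<sigma> assume "\<sigma> \<in> perms_132 (Suc n)"
    then obtain \<alpha> \<beta> where "\<alpha> \<in> perms_132 (n - length \<beta>)" "\<beta> \<in> perms_132 (length \<beta>)"
      "length \<beta> \<le> n" "\<sigma> = join_at_peak \<alpha> \<beta>"
      by (rule perms_132_Suc_obtain_join)
    then show "\<sigma> \<in> ?f ` ?S"
      by (intro image_eqI[of _ _ "(n - length \<beta>, \<alpha>, \<beta>)"]) auto
  qed
qed

section \<open>The generating function\<close>

text \<open>Additivity of the statistic turns the sum over joined pairs into a product of sums.\<close>

lemma Qn_132_Suc:
  "Qn_132 (Suc a) 0 c 0 (Suc n) = (\<Sum>i=0..n. Qn_132 a 0 c 0 i * Qn_132 (Suc a) 0 c 0 (n - i))"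
proof -
  let ?S = "SIGMA i:{0..n}. perms_132 i \<times> perms_132 (n - i)"
  let ?q = "\<lambda>a \<sigma>. monom (1::int) (mmp a 0 c 0 \<sigma>)"
  have "Qn_132 (Suc a) 0 c 0 (Suc n)
      = (\<Sum>(i, \<alpha>, \<beta>)\<in>?S. ?q (Suc a) (join_at_peak \<alpha> \<beta>))"
    unfolding Qn_132_def sum.reindex_bij_betw[OF bij_betw_join_at_peak, symmetric]
    by (simp add: case_prod_unfold)
  also have "\<dots> = (\<Sum>(i, \<alpha>, \<beta>)\<in>?S. ?q a \<alpha> * ?q (Suc a) \<beta>)"
    by (intro sum.cong) (auto simp: mmp_join_at_peak mult_monom)
  also have "\<dots> = (\<Sum>i=0..n. \<Sum>(\<alpha>, \<beta>)\<in>perms_132 i \<times> perms_132 (n - i). ?q a \<alpha> * ?q (Suc a) \<beta>)"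
    by (subst sum.Sigma) (auto simp: finite_perms_132)
  also have "\<dots> = (\<Sum>i=0..n. Qn_132 a 0 c 0 i * Qn_132 (Suc a) 0 c 0 (n - i))"
    by (simp add: Qn_132_def sum_product sum.cartesian_product)
  finally show ?thesis .
qed

lemma Qn_132_0: "Qn_132 a b c d 0 = 1"
proof -
  have "perms_132 0 = {[]}" by (auto simp: perms_132_iff avoids_132_def)
  then show ?thesis by (simp add: Qn_132_def mmp_def)
qed

lemma fps_nth_Q_132: "fps_nth (Q_132 a b c d) n = Qn_132 a b c d n"
  by (simp add: Q_132_def Qn_132_0)

lemma Q_132_functional_equation:
  "Q_132 (Suc a) 0 c 0 = 1 + fps_X * (Q_132 a 0 c 0 * Q_132 (Suc a) 0 c 0)"
proof (rule fps_ext)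
  fix n
  show "fps_nth (Q_132 (Suc a) 0 c 0) n
      = fps_nth (1 + fps_X * (Q_132 a 0 c 0 * Q_132 (Suc a) 0 c 0)) n"
    by (cases n) (simp_all add: fps_nth_Q_132 Qn_132_0 Qn_132_Suc
        fps_mult_nth[of "Q_132 a 0 c 0" "Q_132 (Suc a) 0 c 0"])
qed

theorem theorem5:
  fixes k l :: nat
  assumes "k \<ge> 1" and "l \<ge> 1"
  shows "Q_132 k 0 l 0 = fps_right_inverse (1 - fps_X * Q_132 (k - 1) 0 l 0) 1"
proof -
  obtain a where k: "k = Suc a" using assms(1) by (cases k) auto
  have "(1 - fps_X * Q_132 a 0 l 0) * Q_132 k 0 l 0 = 1"
    using Q_132_functional_equation[of a l] unfolding k
    by (simp add: left_diff_distrib mult.assoc diff_eq_eq)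
  then show ?thesis
    by (subst fps_right_inverse_1_unique) (simp_all add: k)
qed

end
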